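(* Let $\theta\colon\mathbb{Z}\to\mathbb{Z}$, $z\mapsto 0$, be the annihilating homomorphism of the additive group of integers, and let $\tau$ be a Hausdorff locally compact shift-continuous topology on $\mathbf{B}(\mathbb{Z},\theta)^0$ such that the topology induced by $\tau$ on $\mathbf{B}(\mathbb{Z},\theta)$ coincides with $\tau_{\mathbf{cf}}$. Then either $\left(\mathbf{B}(\mathbb{Z},\theta)^0,\tau\right)$ is compact or the zero $\mathbf{0}$ is an isolated point of $\left(\mathbf{B}(\mathbb{Z},\theta)^0,\tau\right)$. Moreover, if $\left(\mathbf{B}(\mathbb{Z},\theta)^0,\tau\right)$ is compact, then the family of all sets $$\mathbf{B}(\mathbb{Z},\theta)^0\setminus\left(M_{1}\cup\cdots\cup M_{k}\right),\qquad k\in\mathbb{N},$$ where each $M_p$ is one of the sets $\{(0,0,j)\}$, $\{(i,0,0)\}$ or $\widetilde{\mathbb{Z}}_{m,n}^0$ with $i,j,m,n\in\mathbb{N}_0$, is a base of the topology $\tau$ at $\mathbf{0}$.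
   Context: $\mathbb{N}$ is the set of positive integers and $\mathbb{N}_0$ the set of non-negative integers. A topology on a semigroup is shift-continuous if multiplication is separately continuous. The Reilly semigroup $\mathbf{B}(\mathbb{Z},\theta)$ is the set $\mathbb{N}_0\times\mathbb{Z}\times\mathbb{N}_0$ with $$(i,s,j)\cdot(m,t,n)=\left(i+m-\min\{j,m\},\ \theta^{m-\min\{j,m\}}(s)+\theta^{j-\min\{j,m\}}(t),\ j+n-\min\{j,m\}\right),$$ where $\theta^0$ is the identity map and $\theta^k$ is the $k$-fold iterate. $\mathbf{B}(\mathbb{Z},\theta)^0=\mathbf{B}(\mathbb{Z},\theta)\sqcup\{\mathbf{0}\}$ is $\mathbf{B}(\mathbb{Z},\theta)$ with an adjoined zero $\mathbf{0}$. For $A\subseteq\mathbb{Z}$ and $i,j\in\mathbb{N}_0$ put $A_{i,j}=\{(i,s,j)\colon s\in A\}$ and $A_{i,j}^0=A_{i,j}\cup\{(i+1,0,j+1)\}$; also $\widetilde{\mathbb{Z}}_{m,n}^0=\mathbb{Z}_{m,n}^0\setminus\{(m,0,n)\}$. The topology $\tau_{\mathbf{cf}}$ on $\mathbf{B}(\mathbb{Z},\theta)$: a point $(i,g,j)$ is isolated if $g\neq 0$, or $i=0$, or $j=0$; for $i,j\in\mathbb{N}$ a base at $(i,0,j)$ consists of all sets $(\mathbb{Z}\setminus F)_{i-1,j-1}^0$, $F$ a finite subset of $\mathbb{Z}$. *)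

theory Defs
  imports "HOL-Analysis.Analysis"
begin

type_synonym reilly = "nat \<times> int \<times> nat"

fun reilly_mult :: "(int \<Rightarrow> int) \<Rightarrow> reilly \<Rightarrow> reilly \<Rightarrow> reilly" where
  "reilly_mult \<theta> (i, s, j) (m, t, n) =
     (i + m - min j m,
      (\<theta> ^^ (m - min j m)) s + (\<theta> ^^ (j - min j m)) t,
      j + n - min j m)"

text \<open>Adjoining a zero: \<open>None\<close> is the new zero, and \<open>Some\<close> is the inclusion.\<close>

fun adjoin_zero :: "('a \<Rightarrow> 'a \<Rightarrow> 'a) \<Rightarrow> 'a option \<Rightarrow> 'a option \<Rightarrow> 'a option" where
  "adjoin_zero f (Some x) (Some y) = Some (f x y)"
| "adjoin_zero f None y = None"
| "adjoin_zero f (Some x) None = None"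

definition shift_continuous :: "('a \<Rightarrow> 'a \<Rightarrow> 'a) \<Rightarrow> 'a topology \<Rightarrow> bool" where
  "shift_continuous f T \<longleftrightarrow>
     (\<forall>a\<in>topspace T. continuous_map T T (\<lambda>x. f a x) \<and> continuous_map T T (\<lambda>x. f x a))"

definition base_at :: "'a topology \<Rightarrow> 'a \<Rightarrow> 'a set set \<Rightarrow> bool" where
  "base_at T x \<B> \<longleftrightarrow>
     (\<forall>B\<in>\<B>. openin T B \<and> x \<in> B) \<and>
     (\<forall>U. openin T U \<and> x \<in> U \<longrightarrow> (\<exists>B\<in>\<B>. B \<subseteq> U))"

definition block :: "int set \<Rightarrow> nat \<Rightarrow> nat \<Rightarrow> reilly set" where
  "block A i j = {(i, s, j) | s. s \<in> A}"

definition block0 :: "int set \<Rightarrow> nat \<Rightarrow> nat \<Rightarrow> reilly set" where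
  "block0 A i j = block A i j \<union> {(i + 1, 0, j + 1)}"

definition punctured_block0 :: "nat \<Rightarrow> nat \<Rightarrow> reilly set" where
  "punctured_block0 m n = block0 UNIV m n - {(m, 0, n)}"

fun cf_base :: "reilly \<Rightarrow> reilly set set" where
  "cf_base (i, g, j) =
     (if g \<noteq> 0 \<or> i = 0 \<or> j = 0 then {{(i, g, j)}}
      else {block0 (UNIV - F) (i - 1) (j - 1) | F. finite F})"

text \<open>
  The families \<open>cf_base x\<close> are bases of neighbourhoods that need not be open: if \<open>0 \<notin> F\<close> and
  \<open>i, j \<ge> 2\<close>, then \<open>block0 (UNIV - F) (i - 1) (j - 1)\<close> contains the non-isolated point
  \<open>(i - 1, 0, j - 1)\<close> but no neighbourhood of it. (Declaring these sets open would make
  that point isolated.) Lemma \<open>tau_cf_neighbourhoods\<close> states that \<open>cf_base x\<close>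
  generates exactly the neighbourhood filter of \<open>x\<close>.
\<close>

definition tau_cf :: "reilly topology" where
  "tau_cf = topology (\<lambda>U. \<forall>x\<in>U. \<exists>V\<in>cf_base x. V \<subseteq> U)"

lemma cf_base_directed:
  assumes "V \<in> cf_base x" "W \<in> cf_base x"
  shows "\<exists>B\<in>cf_base x. B \<subseteq> V \<inter> W"
proof -
  obtain i g j where x: "x = (i, g, j)" by (cases x) auto
  show ?thesis
  proof (cases "g \<noteq> 0 \<or> i = 0 \<or> j = 0")
    case True
    then show ?thesis using assms x by auto
  next
    case False
    then obtain F G where FG: "finite F" "finite G"
      "V = block0 (UNIV - F) (i - 1) (j - 1)" "W = block0 (UNIV - G) (i - 1) (j - 1)"
      using assms x by auto
    have "block0 (UNIV - (F \<union> G)) (i - 1) (j - 1) \<in> cf_base x"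
      using False FG(1,2) x by auto
    moreover have "block0 (UNIV - (F \<union> G)) (i - 1) (j - 1) \<subseteq> V \<inter> W"
      unfolding FG by (auto simp: block0_def block_def)
    ultimately show ?thesis by blast
  qed
qed

lemma istopology_cf: "istopology (\<lambda>U. \<forall>x\<in>U. \<exists>V\<in>cf_base x. V \<subseteq> U)"
  unfolding istopology_def
proof (intro conjI allI impI ballI)
  fix S T x
  assume "\<forall>x\<in>S. \<exists>V\<in>cf_base x. V \<subseteq> S" "\<forall>x\<in>T. \<exists>V\<in>cf_base x. V \<subseteq> T" "x \<in> S \<inter> T"
  then obtain V W where "V \<in> cf_base x" "V \<subseteq> S" "W \<in> cf_base x" "W \<subseteq> T"
    by blast
  then show "\<exists>V\<in>cf_base x. V \<subseteq> S \<inter> T"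
    using cf_base_directed[of V x W] by blast
next
  fix \<K> x
  assume "\<forall>K\<in>\<K>. \<forall>x\<in>K. \<exists>V\<in>cf_base x. V \<subseteq> K" "x \<in> \<Union>\<K>"
  then show "\<exists>V\<in>cf_base x. V \<subseteq> \<Union>\<K>"
    by (meson UnionE Union_upper subset_trans)
qed

lemma openin_tau_cf: "openin tau_cf U \<longleftrightarrow> (\<forall>x\<in>U. \<exists>V\<in>cf_base x. V \<subseteq> U)"
  unfolding tau_cf_def using topology_inverse'[OF istopology_cf] by simp

lemma cf_base_nonempty: "cf_base x \<noteq> {}"
  by (cases x) auto

lemma cf_base_contains: "V \<in> cf_base x \<Longrightarrow> x \<in> V"
  by (cases x) (auto simp: block0_def split: if_splits)

lemma topspace_tau_cf: "topspace tau_cf = UNIV"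
proof -
  have "openin tau_cf UNIV"
    unfolding openin_tau_cf using cf_base_nonempty by fastforce
  then show ?thesis by (metis openin_subset top.extremum_uniqueI)
qed

lemma tau_cf_neighbourhoods:
  "(\<exists>U. openin tau_cf U \<and> x \<in> U \<and> U \<subseteq> W) \<longleftrightarrow> (\<exists>V\<in>cf_base x. V \<subseteq> W)"
proof
  assume "\<exists>U. openin tau_cf U \<and> x \<in> U \<and> U \<subseteq> W"
  then show "\<exists>V\<in>cf_base x. V \<subseteq> W"
    unfolding openin_tau_cf by (meson subset_trans)
next
  assume "\<exists>V\<in>cf_base x. V \<subseteq> W"
  then obtain V where V: "V \<in> cf_base x" "V \<subseteq> W" by blast
  obtain i g j where x: "x = (i, g, j)" by (cases x) auto
  show "\<exists>U. openin tau_cf U \<and> x \<in> U \<and> U \<subseteq> W"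
  proof (cases "g \<noteq> 0 \<or> i = 0 \<or> j = 0")
    case True
    then have "openin tau_cf {x}" unfolding openin_tau_cf using x by auto
    then show ?thesis using V True x by auto
  next
    case False
    then obtain F where F: "finite F" "V = block0 (UNIV - F) (i - 1) (j - 1)"
      using V x by auto
    let ?U = "block0 (UNIV - insert 0 F) (i - 1) (j - 1)"
    have *: "x \<in> ?U" using x False by (auto simp: block0_def)
    have "openin tau_cf ?U"
      unfolding openin_tau_cf
    proof
      fix y assume y: "y \<in> ?U"
      show "\<exists>V\<in>cf_base y. V \<subseteq> ?U"
      proof (cases "y = x")
        case True
        have "?U \<in> cf_base x" using x False F(1) by (auto intro!: exI[of _ "insert 0 F"])
        then show ?thesis using True by blast
      next
        case ne: False
        then obtain s where "s \<noteq> 0" "y = (i - 1, s, j - 1)"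
          using y x False by (auto simp: block0_def block_def)
        then show ?thesis using y by auto
      qed
    qed
    moreover have "?U \<subseteq> W" using V(2) F(2) by (auto simp: block0_def block_def)
    ultimately show ?thesis using * by blast
  qed
qed

definition removable_sets :: "reilly set set" where
  "removable_sets =
     {{(0, 0, j)} | j. True} \<union> {{(i, 0, 0)} | i. True} \<union> {punctured_block0 m n | m n. True}"

definition zero_base :: "reilly option set set" where
  "zero_base =
     {UNIV - (\<Union>p\<in>{1..k}. Some ` M p) | (k::nat) M. k \<ge> 1 \<and> (\<forall>p\<in>{1..k}. M p \<in> removable_sets)}"

end

theory Submission
  imports Defs
begin

text \<open>
  The space \<open>B(\<int>, \<theta>)\<close> with the topology \<open>tau_cf\<close> is the disjoint union of the removable sets, and each
  of them is compact and open: \<open>punctured_block0 m n\<close> is the one-point compactification of the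
  discrete set of the \<open>(m, s, n)\<close> with \<open>s \<noteq> 0\<close>, with \<open>(m + 1, 0, n + 1)\<close> as the point at infinity.
  So a set is relatively compact in \<open>B(\<int>, \<theta>)\<close> iff finitely many removable sets cover it, and that
  holds iff the two outer coordinates are bounded on it.

  Local compactness yields a compact open neighbourhood \<open>K\<close> of the zero
  (\<open>compact_open_neighbourhood\<close>). For a fixed element \<open>a\<close>, the points \<open>x\<close> with \<open>a x \<in> K\<close> form a
  neighbourhood of the zero, so their complement in the compact set \<open>K\<close> is bounded: up to a bounded
  set, \<open>K\<close> is invariant under each left and each right multiplication. Multiplications by \<open>(1, 0, 0)\<close> and
  \<open>(0, 0, 1)\<close> move the piece with index \<open>(m, n)\<close> to the neighbouring ones, so outside a finite square of
  indices \<open>K\<close> has the same trace on every piece. Left multiplications by \<open>(0, s, 0)\<close> translate the row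
  \<open>m = 0\<close>, so a trace with one finite point has all of them; as \<open>K\<close> is
  clopen, this trace is empty or everything. This dichotomy is \<open>bounded_or_cobounded\<close>. If the
  trace is empty, deleting finitely many pieces from \<open>K\<close> leaves only the zero, which is then isolated;
  if it is everything, \<open>K\<close> and finitely many pieces cover the space, which is then compact.
  In the compact case the complement of any open neighbourhood of the zero is a compact
  part of \<open>B(\<int>, \<theta>)\<close>, hence covered by finitely many pieces.
\<close>

section \<open>Multiplication for the annihilating endomorphism\<close>

abbreviation annihilating_mult :: "reilly \<Rightarrow> reilly \<Rightarrow> reilly" where
  "annihilating_mult \<equiv> reilly_mult (\<lambda>z. 0)"

lemma funpow_zero_map [simp]: "((\<lambda>z::int. 0::int) ^^ k) 0 = 0"
  by (cases k) auto

lemma annihilating_mult_shifts: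
  "annihilating_mult (1, 0, 0) (m, t, n) = (Suc m, t, n)"
  "annihilating_mult (0, 0, 1) (Suc m, t, n) = (m, t, n)"
  "annihilating_mult (m, t, n) (0, 0, 1) = (m, t, Suc n)"
  "annihilating_mult (m, t, Suc n) (1, 0, 0) = (m, t, n)"
  by auto

section \<open>Boundedness and compactness of the pieces\<close>

text \<open>Boundedness concerns the two outer coordinates only, because a single piece already contains
  infinitely many middle coordinates.\<close>

definition bounded_index :: "reilly set \<Rightarrow> bool" where
  "bounded_index A \<longleftrightarrow> (\<exists>M. \<forall>i s j. (i, s, j) \<in> A \<longrightarrow> i \<le> M \<and> j \<le> M)"

lemma bounded_index_subset: "A \<subseteq> B \<Longrightarrow> bounded_index B \<Longrightarrow> bounded_index A"
  unfolding bounded_index_def by (meson subsetD)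

lemma mem_punctured_block0:
  "x \<in> punctured_block0 m n \<longleftrightarrow> (\<exists>s. s \<noteq> 0 \<and> x = (m, s, n)) \<or> x = (Suc m, 0, Suc n)"
  by (auto simp: punctured_block0_def block0_def block_def)

lemma bounded_index_Union_removable:
  assumes "finite \<F>" "\<F> \<subseteq> removable_sets"
  shows "bounded_index (\<Union>\<F>)"
  using assms
proof (induction rule: finite_induct)
  case empty
  then show ?case by (simp add: bounded_index_def)
next
  case (insert R \<F>)
  have "R \<in> removable_sets" using insert.prems by simp
  then have "\<exists>M. \<forall>i s j. (i, s, j) \<in> R \<longrightarrow> i \<le> M \<and> j \<le> M"
  proof -
    consider j where "R = {(0, 0, j)}" | i where "R = {(i, 0, 0)}"
      | m n where "R = punctured_block0 m n"
      using \<open>R \<in> removable_sets\<close> by (auto simp: removable_sets_def)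
    then show ?thesis
    proof cases
      case (3 m n)
      then show ?thesis
        by (intro exI[of _ "Suc (max m n)"]) (auto simp: mem_punctured_block0)
    qed auto
  qed
  then obtain M where M: "\<And>i s j. (i, s, j) \<in> R \<Longrightarrow> i \<le> M \<and> j \<le> M" by blast
  obtain N where N: "\<And>i s j. (i, s, j) \<in> \<Union>\<F> \<Longrightarrow> i \<le> N \<and> j \<le> N"
    using insert by (auto simp: bounded_index_def)
  have "i \<le> max M N \<and> j \<le> max M N" if "(i, s, j) \<in> \<Union>(insert R \<F>)" for i s j
    using that M[of i s j] N[of i s j] by (auto simp: le_max_iff_disj)
  then show ?case unfolding bounded_index_def by blast
qed

lemma bounded_index_cover:
  assumes "bounded_index A"
  obtains \<F> where "finite \<F>" "\<F> \<subseteq> removable_sets" "A \<subseteq> \<Union>\<F>"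
proof -
  obtain M where M: "\<And>i s j. (i, s, j) \<in> A \<Longrightarrow> i \<le> M \<and> j \<le> M"
    using assms by (auto simp: bounded_index_def)
  define \<F> where "\<F> = (\<lambda>j. {(0, 0, j)}) ` {..M} \<union> (\<lambda>i. {(i, 0, 0)}) ` {..M}
    \<union> (\<lambda>(m, n). punctured_block0 m n) ` ({..M} \<times> {..M})"
  have "finite \<F>" unfolding \<F>_def by simp
  moreover have "\<F> \<subseteq> removable_sets"
    unfolding \<F>_def removable_sets_def by auto
  moreover have "A \<subseteq> \<Union>\<F>"
  proof
    fix x assume "x \<in> A"
    obtain i s j where x: "x = (i, s, j)" by (cases x) auto
    have ij: "i \<le> M" "j \<le> M" using M \<open>x \<in> A\<close> x by auto
    consider "s \<noteq> 0" | "s = 0" "i = 0" | "s = 0" "j = 0"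
      | m n where "s = 0" "i = Suc m" "j = Suc n"
      by (metis not0_implies_Suc)
    then show "x \<in> \<Union>\<F>"
    proof cases
      case 1
      then have "x \<in> punctured_block0 i j" using x by (simp add: mem_punctured_block0)
      then show ?thesis unfolding \<F>_def using ij by auto
    next
      case 4
      then have "x \<in> punctured_block0 m n" using x by (simp add: mem_punctured_block0)
      then show ?thesis unfolding \<F>_def using ij 4 by auto
    qed (use x ij in \<open>auto simp: \<F>_def\<close>)
  qed
  ultimately show thesis using that by blast
qed

lemma openin_tau_cf_limit:
  "openin tau_cf U \<Longrightarrow> (Suc m, 0, Suc n) \<in> U \<Longrightarrow> finite {s. (m, s, n) \<notin> U}"
proof -
  assume "openin tau_cf U" "(Suc m, 0, Suc n) \<in> U"
  then obtain V where "V \<in> cf_base (Suc m, 0, Suc n)" "V \<subseteq> U"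
    unfolding openin_tau_cf by blast
  then obtain F where "finite F" "block0 (UNIV - F) m n \<subseteq> U"
    by auto
  then have "{s. (m, s, n) \<notin> U} \<subseteq> F"
    by (auto simp: block0_def block_def)
  then show ?thesis using \<open>finite F\<close> finite_subset by blast
qed

lemma openin_removable:
  assumes "R \<in> removable_sets"
  shows "openin tau_cf R"
proof -
  have "openin tau_cf (punctured_block0 m n)" for m n
    unfolding openin_tau_cf
  proof
    fix x assume "x \<in> punctured_block0 m n"
    then consider s where "s \<noteq> 0" "x = (m, s, n)" | "x = (Suc m, 0, Suc n)"
      by (auto simp: mem_punctured_block0)
    then show "\<exists>V\<in>cf_base x. V \<subseteq> punctured_block0 m n"
    proof cases
      case 1
      then show ?thesis by (auto simp: mem_punctured_block0)
    next
      case 2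
      then have "block0 (UNIV - {0}) m n \<in> cf_base x" by auto
      moreover have "block0 (UNIV - {0}) m n \<subseteq> punctured_block0 m n"
        by (auto simp: mem_punctured_block0 block0_def block_def)
      ultimately show ?thesis by blast
    qed
  qed
  moreover have "openin tau_cf {(0, 0, j)}" "openin tau_cf {(i, 0, 0)}" for i j
    by (simp_all add: openin_tau_cf)
  ultimately show ?thesis using assms by (auto simp: removable_sets_def)
qed

lemma compactin_one_limit_point:
  assumes "S \<subseteq> topspace X" "x \<in> S"
    and "\<And>U. openin X U \<Longrightarrow> x \<in> U \<Longrightarrow> finite (S - U)"
  shows "compactin X S"
  unfolding compactin_def
proof (intro conjI allI impI)
  fix \<U> assume \<U>: "(\<forall>U\<in>\<U>. openin X U) \<and> S \<subseteq> \<Union>\<U>"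
  then obtain U where U: "U \<in> \<U>" "x \<in> U" using assms(2) by blast
  then have "finite (S - U)" using \<U> assms(3) by blast
  moreover have "S - U \<subseteq> \<Union>\<U>" using \<U> by blast
  ultimately obtain \<F> where "finite \<F>" "\<F> \<subseteq> \<U>" "S - U \<subseteq> \<Union>\<F>"
    by (rule finite_subset_Union)
  then show "\<exists>\<F>. finite \<F> \<and> \<F> \<subseteq> \<U> \<and> S \<subseteq> \<Union>\<F>"
    using U by (intro exI[of _ "insert U \<F>"]) auto
qed (use assms in blast)

lemma compactin_removable:
  assumes "R \<in> removable_sets"
  shows "compactin tau_cf R"
proof -
  have "compactin tau_cf (punctured_block0 m n)" for m n
  proof (rule compactin_one_limit_point)
    show "(Suc m, 0, Suc n) \<in> punctured_block0 m n" by (simp add: mem_punctured_block0)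
    fix U assume U: "openin tau_cf U" "(Suc m, 0, Suc n) \<in> U"
    then have "punctured_block0 m n - U \<subseteq> (\<lambda>s. (m, s, n)) ` {s. (m, s, n) \<notin> U}"
      by (auto simp: mem_punctured_block0)
    then show "finite (punctured_block0 m n - U)"
      using openin_tau_cf_limit[OF U] finite_surj by blast
  qed (simp add: topspace_tau_cf)
  moreover have "compactin tau_cf {x}" for x by (simp add: topspace_tau_cf)
  ultimately show ?thesis using assms by (auto simp: removable_sets_def)
qed

section \<open>Sets invariant up to a bounded set\<close>

lemma grid_eventually_constant:
  fixes f :: "nat \<Rightarrow> nat \<Rightarrow> 'a"
  assumes right: "\<And>m n. M \<le> m \<or> M \<le> n \<Longrightarrow> f (Suc m) n = f m n"
    and up: "\<And>m n. M \<le> m \<or> M \<le> n \<Longrightarrow> f m (Suc n) = f m n"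
    and out: "M \<le> m \<or> M \<le> n"
  shows "f m n = f M M"
proof -
  \<comment> \<open>The complement of the square is connected: it consists of the full columns \<open>m \<ge> M\<close> and the
    full rows \<open>n \<ge> M\<close>, and each row meets each column.\<close>
  have column: "f m n = f m 0" if "M \<le> m" for m n
    using that by (induction n) (auto simp: up)
  have row: "f m n = f 0 n" if "M \<le> n" for m n
    using that by (induction m) (auto simp: right)
  show ?thesis
    using out column row by (metis order_refl)
qed

text \<open>The hypotheses are what remains of shift-continuity at the zero for the trace \<open>k\<close> on \<open>B(\<int>, \<theta>)\<close> of a
  compact open neighbourhood of the zero. Shifts force the same trace on all pieces far out, and
  translations along the first row and column leave only the empty and the full trace.\<close>

lemma bounded_or_cobounded:
  assumes k_open: "openin tau_cf k" and co_open: "openin tau_cf (- k)"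
    and left: "\<And>a. bounded_index {x \<in> k. annihilating_mult a x \<notin> k}"
    and right: "\<And>a. bounded_index {x \<in> k. annihilating_mult x a \<notin> k}"
  shows "bounded_index k \<or> bounded_index (- k)"
proof -
  have ev_left: "\<exists>M. \<forall>i s j. (i, s, j) \<in> k \<longrightarrow> M \<le> i \<or> M \<le> j \<longrightarrow> annihilating_mult a (i, s, j) \<in> k"
    for a
  proof -
    obtain M where "\<And>i s j. (i, s, j) \<in> k \<Longrightarrow> annihilating_mult a (i, s, j) \<notin> k \<Longrightarrow> i \<le> M \<and> j \<le> M"
      using left[of a] unfolding bounded_index_def by blast
    then show ?thesis by (intro exI[of _ "Suc M"]) (meson not_less_eq_eq)
  qed
  have ev_right: "\<exists>M. \<forall>i s j. (i, s, j) \<in> k \<longrightarrow> M \<le> i \<or> M \<le> j \<longrightarrow> annihilating_mult (i, s, j) a \<in> k"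
    for a
  proof -
    obtain M where "\<And>i s j. (i, s, j) \<in> k \<Longrightarrow> annihilating_mult (i, s, j) a \<notin> k \<Longrightarrow> i \<le> M \<and> j \<le> M"
      using right[of a] unfolding bounded_index_def by blast
    then show ?thesis by (intro exI[of _ "Suc M"]) (meson not_less_eq_eq)
  qed
  obtain M1 where M1: "\<And>i s j. (i, s, j) \<in> k \<Longrightarrow> M1 \<le> i \<or> M1 \<le> j \<Longrightarrow> (Suc i, s, j) \<in> k"
    using ev_left[of "(1, 0, 0)"] unfolding annihilating_mult_shifts by blast
  obtain M2 where M2: "\<And>i s j. (Suc i, s, j) \<in> k \<Longrightarrow> M2 \<le> Suc i \<or> M2 \<le> j \<Longrightarrow> (i, s, j) \<in> k"
    using ev_left[of "(0, 0, 1)"] annihilating_mult_shifts(2) by metis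
  obtain M3 where M3: "\<And>i s j. (i, s, j) \<in> k \<Longrightarrow> M3 \<le> i \<or> M3 \<le> j \<Longrightarrow> (i, s, Suc j) \<in> k"
    using ev_right[of "(0, 0, 1)"] unfolding annihilating_mult_shifts by blast
  obtain M4 where M4: "\<And>i s j. (i, s, Suc j) \<in> k \<Longrightarrow> M4 \<le> i \<or> M4 \<le> Suc j \<Longrightarrow> (i, s, j) \<in> k"
    using ev_right[of "(1, 0, 0)"] annihilating_mult_shifts(4) by metis
  define M where "M = Max {M1, M2, M3, M4}"
  have M_ge: "M1 \<le> M" "M2 \<le> M" "M3 \<le> M" "M4 \<le> M" unfolding M_def by simp_all
  have vert: "(Suc i, s, j) \<in> k \<longleftrightarrow> (i, s, j) \<in> k" if "M \<le> i \<or> M \<le> j" for i s j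
    using M1[of i s j] M2[of i s j] M_ge that by auto
  have horiz: "(i, s, Suc j) \<in> k \<longleftrightarrow> (i, s, j) \<in> k" if "M \<le> i \<or> M \<le> j" for i s j
    using M3[of i s j] M4[of i s j] M_ge that by auto

  \<comment> \<open>The trace of \<open>k\<close> on the piece with index \<open>(m, n)\<close>: its finite points, and whether it has the point
    at infinity.\<close>
  define trace where "trace m n = ({s. s \<noteq> 0 \<and> (m, s, n) \<in> k}, (Suc m, 0::int, Suc n) \<in> k)" for m n
  have const: "trace m n = trace M M" if "M \<le> m \<or> M \<le> n" for m n
  proof (rule grid_eventually_constant[where M = M, OF _ _ that])
    show "trace (Suc m) n = trace m n" if "M \<le> m \<or> M \<le> n" for m n
      using that vert[of m n] vert[of "Suc m" "Suc n" 0] unfolding trace_def by auto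
    show "trace m (Suc n) = trace m n" if "M \<le> m \<or> M \<le> n" for m n
      using that horiz[of m n] horiz[of "Suc m" "Suc n" 0] unfolding trace_def by auto
  qed
  have finite_pt: "(m, s, n) \<in> k \<longleftrightarrow> (M, s, M) \<in> k" if "M \<le> m \<or> M \<le> n" "s \<noteq> 0" for m n s
    using const[OF that(1)] that(2) unfolding trace_def by blast
  have limit_pt: "(Suc m, 0, Suc n) \<in> k \<longleftrightarrow> (Suc M, 0, Suc M) \<in> k" if "M \<le> m \<or> M \<le> n" for m n
    using const[OF that] unfolding trace_def by blast
  have cases_outside: thesis
    if out: "Suc M < i \<or> Suc M < j" and "s \<noteq> 0 \<Longrightarrow> thesis" "s = 0 \<Longrightarrow> i = 0 \<Longrightarrow> thesis"
      "s = 0 \<Longrightarrow> j = 0 \<Longrightarrow> thesis"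
      "\<And>m n. s = 0 \<Longrightarrow> i = Suc m \<Longrightarrow> j = Suc n \<Longrightarrow> M \<le> m \<or> M \<le> n \<Longrightarrow> thesis"
    for i j and s :: int and thesis
    using that by (cases i; cases j; cases "s = 0") auto

  show ?thesis
  proof (cases "\<exists>t. t \<noteq> 0 \<and> (M, t, M) \<in> k")
    case False
    \<comment> \<open>A neighbourhood of the point at infinity has finite points, so the trace is empty.\<close>
    have no_limit: "(Suc M, 0, Suc M) \<notin> k"
    proof
      assume "(Suc M, 0, Suc M) \<in> k"
      then have "finite {s. (M, s, M) \<notin> k}" by (rule openin_tau_cf_limit[OF k_open])
      moreover have "UNIV \<subseteq> insert 0 {s. (M, s, M) \<notin> k}" using False by auto
      ultimately show False
        using infinite_UNIV_int by (meson finite.insertI finite_subset)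
    qed
    \<comment> \<open>The isolated points \<open>(0, 0, j)\<close> and \<open>(i, 0, 0)\<close> shift to points at infinity of pieces.\<close>
    have "i \<le> Suc M \<and> j \<le> Suc M" if "(i, s, j) \<in> k" for i s j
    proof (rule ccontr)
      assume "\<not> ?thesis"
      then have out: "Suc M < i \<or> Suc M < j" by auto
      then show False
      proof (rule cases_outside[where s = s])
        assume "s \<noteq> 0"
        then show False using finite_pt[of i j s] out that False by auto
      next
        assume *: "s = 0" "i = 0"
        then obtain n where n: "j = Suc n" "M \<le> n" using out by (cases j) auto
        then have "(Suc 0, 0, Suc n) \<in> k" using vert[of 0 j 0] that * by auto
        then show False using limit_pt[of 0 n] n no_limit by auto
      next
        assume *: "s = 0" "j = 0"
        then obtain m where m: "i = Suc m" "M \<le> m" using out by (cases i) auto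
        then have "(Suc m, 0, Suc 0) \<in> k" using horiz[of i 0 0] that * by auto
        then show False using limit_pt[of m 0] m no_limit by auto
      next
        fix m n assume "s = 0" "i = Suc m" "j = Suc n" "M \<le> m \<or> M \<le> n"
        then show False using limit_pt[of m n] no_limit that by auto
      qed
    qed
    then show ?thesis unfolding bounded_index_def by blast
  next
    case True
    then obtain t where t: "t \<noteq> 0" "(M, t, M) \<in> k" by blast
    \<comment> \<open>Far out in the row \<open>i = 0\<close>, multiplication by \<open>(0, r - t, 0)\<close> takes \<open>(0, t, j)\<close> to \<open>(0, r, j)\<close>.\<close>
    have all_finite: "(M, r, M) \<in> k" if "r \<noteq> 0" for r
    proof -
      obtain N where N: "\<And>i s j. (i, s, j) \<in> k \<Longrightarrow> N \<le> i \<or> N \<le> j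
          \<Longrightarrow> annihilating_mult (0, r - t, 0) (i, s, j) \<in> k"
        using ev_left[of "(0, r - t, 0)"] by blast
      have "(0, t, max M N) \<in> k" using finite_pt[of 0 "max M N" t] t by auto
      then have "(0, r, max M N) \<in> k" using N[of 0 t "max M N"] by simp
      then show ?thesis using finite_pt[of 0 "max M N" r] that by auto
    qed
    have limit: "(Suc M, 0, Suc M) \<in> k"
    proof (rule ccontr)
      assume "(Suc M, 0, Suc M) \<notin> k"
      then have "finite {s. (M, s, M) \<notin> - k}" using openin_tau_cf_limit[OF co_open] by simp
      moreover have "UNIV \<subseteq> insert 0 {s. (M, s, M) \<notin> - k}" using all_finite by auto
      ultimately show False
        using infinite_UNIV_int by (meson finite.insertI finite_subset)
    qed
    \<comment> \<open>Translating by \<open>-1\<close> brings \<open>(0, 1, j)\<close> and \<open>(i, 1, 0)\<close> to the isolated points of the first row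
      and column.\<close>
    obtain N1 where N1: "\<And>i s j. (i, s, j) \<in> k \<Longrightarrow> N1 \<le> i \<or> N1 \<le> j
        \<Longrightarrow> annihilating_mult (0, -1, 0) (i, s, j) \<in> k"
      using ev_left[of "(0, -1, 0)"] by blast
    obtain N2 where N2: "\<And>i s j. (i, s, j) \<in> k \<Longrightarrow> N2 \<le> i \<or> N2 \<le> j
        \<Longrightarrow> annihilating_mult (i, s, j) (0, -1, 0) \<in> k"
      using ev_right[of "(0, -1, 0)"] by blast
    define N where "N = Max {Suc M, N1, N2}"
    have N_ge: "Suc M \<le> N" "N1 \<le> N" "N2 \<le> N" unfolding N_def by simp_all
    have "i \<le> N \<and> j \<le> N" if "(i, s, j) \<in> - k" for i s j
    proof (rule ccontr)
      assume "\<not> ?thesis"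
      then have outN: "N < i \<or> N < j" by auto
      then have out: "Suc M < i \<or> Suc M < j" using N_ge by auto
      then have "(i, s, j) \<in> k"
      proof (rule cases_outside[where s = s])
        assume "s \<noteq> 0"
        then show ?thesis using finite_pt[of i j s] out all_finite by auto
      next
        assume *: "s = 0" "i = 0"
        have "(0, 1, j) \<in> k" using finite_pt[of 0 j 1] all_finite out * by auto
        then show ?thesis using N1[of 0 1 j] outN N_ge * by auto
      next
        assume *: "s = 0" "j = 0"
        have "(i, 1, 0) \<in> k" using finite_pt[of i 0 1] all_finite out * by auto
        then show ?thesis using N2[of i 1 0] outN N_ge * by auto
      next
        fix m n assume "s = 0" "i = Suc m" "j = Suc n" "M \<le> m \<or> M \<le> n"
        then show ?thesis using limit_pt[of m n] limit by auto
      qed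
      then show False using that by simp
    qed
    then show ?thesis unfolding bounded_index_def by blast
  qed
qed

section \<open>Locally compact topologies with an adjoined zero\<close>

locale locally_compact_reilly_zero =
  fixes \<tau> :: "reilly option topology"
  assumes topspace_tau: "topspace \<tau> = UNIV"
    and Hausdorff_tau: "Hausdorff_space \<tau>"
    and locally_compact_tau: "locally_compact_space \<tau>"
    and shift_continuous_tau: "shift_continuous (adjoin_zero annihilating_mult) \<tau>"
    and pullback_tau: "pullback_topology UNIV Some \<tau> = tau_cf"
begin

lemma openin_vimage_Some: "openin \<tau> U \<Longrightarrow> openin tau_cf {x. Some x \<in> U}"
  unfolding pullback_tau[symmetric] openin_pullback_topology by auto

text \<open>Points are closed in \<open>\<tau>\<close>, so \<open>B(\<int>, \<theta>)\<close> is an open subspace.\<close>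

lemma openin_image_Some:
  assumes "openin tau_cf W"
  shows "openin \<tau> (Some ` W)"
proof -
  obtain U where U: "openin \<tau> U" "W = Some -` U"
    using assms unfolding pullback_tau[symmetric] openin_pullback_topology by auto
  have "closedin \<tau> {None}"
    using Hausdorff_tau topspace_tau by (simp add: closedin_Hausdorff_singleton)
  then have "openin \<tau> (U - {None})" using U openin_diff by blast
  moreover have "U - {None} = Some ` W"
  proof (intro set_eqI)
    fix y show "y \<in> U - {None} \<longleftrightarrow> y \<in> Some ` W"
      using U by (cases y) auto
  qed
  ultimately show ?thesis by simp
qed

lemma continuous_map_Some: "continuous_map tau_cf \<tau> Some"
  by (auto simp: continuous_map_def topspace_tau topspace_tau_cf openin_vimage_Some)

lemma removable_Union:
  assumes "finite \<F>" "\<F> \<subseteq> removable_sets"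
  shows openin_image_removable_Union: "openin \<tau> (Some ` \<Union>\<F>)"
    and compactin_image_removable_Union: "compactin \<tau> (Some ` \<Union>\<F>)"
    and closedin_image_removable_Union: "closedin \<tau> (Some ` \<Union>\<F>)"
proof -
  show "openin \<tau> (Some ` \<Union>\<F>)"
    by (rule openin_image_Some, rule openin_Union) (use assms openin_removable in blast)
  have "compactin tau_cf (\<Union>\<F>)"
    by (rule compactin_Union) (use assms compactin_removable in blast)+
  then show "compactin \<tau> (Some ` \<Union>\<F>)"
    by (rule image_compactin[OF _ continuous_map_Some])
  then show "closedin \<tau> (Some ` \<Union>\<F>)"
    by (rule compactin_imp_closedin[OF Hausdorff_tau])
qed

text \<open>The removable sets cover \<open>B(\<int>, \<theta>)\<close> and are open.\<close>

lemma compactin_removable_cover: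
  assumes "compactin \<tau> C" "None \<notin> C"
  obtains \<F> where "finite \<F>" "\<F> \<subseteq> removable_sets" "C \<subseteq> Some ` \<Union>\<F>"
proof -
  have "C \<subseteq> \<Union>((`) Some ` removable_sets)"
  proof
    fix y assume "y \<in> C"
    then obtain x where x: "y = Some x" using assms(2) by (cases y) auto
    have "bounded_index {x}" unfolding bounded_index_def
      by (cases x) (auto intro: exI[of _ "max (fst x) (snd (snd x))"])
    then obtain \<F> where "\<F> \<subseteq> removable_sets" "{x} \<subseteq> \<Union>\<F>" by (rule bounded_index_cover)
    then show "y \<in> \<Union>((`) Some ` removable_sets)" using x by blast
  qed
  moreover have "openin \<tau> V" if "V \<in> (`) Some ` removable_sets" for V
    using that openin_image_Some openin_removable by blast
  ultimately obtain \<G> where \<G>: "finite \<G>" "\<G> \<subseteq> (`) Some ` removable_sets" "C \<subseteq> \<Union>\<G>"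
    using assms(1) unfolding compactin_def by meson
  then obtain \<F> where "\<F> \<subseteq> removable_sets" "finite \<F>" "\<G> = (`) Some ` \<F>"
    by (meson finite_subset_image)
  then show thesis using that \<G>(3) by (metis image_Union)
qed

text \<open>The boundary of a neighbourhood with compact closure is compact and misses the zero, so
  removing finitely many pieces from such a neighbourhood makes it compact.\<close>

lemma compact_open_neighbourhood:
  obtains K where "openin \<tau> K" "compactin \<tau> K" "None \<in> K"
proof -
  have "\<exists>U V. openin \<tau> U \<and> compactin \<tau> V \<and> None \<in> U \<and> U \<subseteq> V"
    using locally_compact_tau by (simp add: locally_compact_space_def topspace_tau)
  then obtain U V where UV: "openin \<tau> U" "compactin \<tau> V" "None \<in> U" "U \<subseteq> V"
    by (elim exE conjE)
  have "compactin \<tau> (V \<inter> (topspace \<tau> - U))"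
    by (rule compact_Int_closedin[OF UV(2)]) (use UV in blast)
  moreover have "None \<notin> V \<inter> (topspace \<tau> - U)" using UV(3) by blast
  ultimately obtain \<F> where \<F>: "finite \<F>" "\<F> \<subseteq> removable_sets"
    "V \<inter> (topspace \<tau> - U) \<subseteq> Some ` \<Union>\<F>"
    by (rule compactin_removable_cover)
  have eq: "U - Some ` \<Union>\<F> = V \<inter> (topspace \<tau> - Some ` \<Union>\<F>)"
    using \<F>(3) UV(4) by (auto simp: topspace_tau)
  show thesis
  proof
    show "openin \<tau> (U - Some ` \<Union>\<F>)"
      using UV(1) closedin_image_removable_Union[OF \<F>(1,2)] by (rule openin_diff)
    show "compactin \<tau> (U - Some ` \<Union>\<F>)"
      unfolding eq
      by (rule compact_Int_closedin[OF UV(2)])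
        (use openin_image_removable_Union[OF \<F>(1,2)] in blast)
    show "None \<in> U - Some ` \<Union>\<F>" using UV(3) by blast
  qed
qed

text \<open>This turns continuity of a shift at the zero into invariance of \<open>K\<close> up to a bounded set: the
  preimage of \<open>K\<close> is an open neighbourhood of the zero, so what it omits of the compact set \<open>K\<close> is
  a compact part of \<open>B(\<int>, \<theta>)\<close>.\<close>

lemma bounded_outside_preimage:
  assumes "openin \<tau> K" "compactin \<tau> K" "None \<in> K"
    and "continuous_map \<tau> \<tau> h" "h None = None"
  shows "bounded_index {x. Some x \<in> K \<and> h (Some x) \<notin> K}"
proof -
  let ?W = "{y \<in> topspace \<tau>. h y \<in> K}"
  have "openin \<tau> ?W" using assms(4,1) by (rule openin_continuous_map_preimage)
  then have "compactin \<tau> (K \<inter> (topspace \<tau> - ?W))"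
    by (intro compact_Int_closedin[OF assms(2)]) blast
  moreover have "None \<notin> K \<inter> (topspace \<tau> - ?W)"
    using assms(3,5) topspace_tau by simp
  ultimately obtain \<F> where \<F>: "finite \<F>" "\<F> \<subseteq> removable_sets"
    "K \<inter> (topspace \<tau> - ?W) \<subseteq> Some ` \<Union>\<F>"
    by (rule compactin_removable_cover)
  have "{x. Some x \<in> K \<and> h (Some x) \<notin> K} \<subseteq> \<Union>\<F>"
    using \<F>(3) topspace_tau by blast
  then show ?thesis
    using bounded_index_Union_removable[OF \<F>(1,2)] by (rule bounded_index_subset)
qed

lemma compact_or_zero_isolated: "compact_space \<tau> \<or> openin \<tau> {None}"
proof -
  obtain K where K: "openin \<tau> K" "compactin \<tau> K" "None \<in> K"
    by (rule compact_open_neighbourhood)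
  define k where "k = {x. Some x \<in> K}"
  have "openin \<tau> (topspace \<tau> - K)"
    using compactin_imp_closedin[OF Hausdorff_tau K(2)] by blast
  then have "openin tau_cf (- k)"
    using openin_vimage_Some topspace_tau unfolding k_def
    by (metis (no_types, lifting) Collect_cong Collect_neg_eq Diff_iff UNIV_I)
  moreover have "openin tau_cf k" unfolding k_def using K(1) by (rule openin_vimage_Some)
  moreover have "bounded_index {x \<in> k. annihilating_mult a x \<notin> k}" for a
  proof -
    have "continuous_map \<tau> \<tau> (adjoin_zero annihilating_mult (Some a))"
      using shift_continuous_tau topspace_tau unfolding shift_continuous_def by simp
    from bounded_outside_preimage[OF K this] show ?thesis by (simp add: k_def)
  qed
  moreover have "bounded_index {x \<in> k. annihilating_mult x a \<notin> k}" for a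
  proof -
    have "continuous_map \<tau> \<tau> (\<lambda>y. adjoin_zero annihilating_mult y (Some a))"
      using shift_continuous_tau topspace_tau unfolding shift_continuous_def by simp
    from bounded_outside_preimage[OF K this] show ?thesis by (simp add: k_def)
  qed
  ultimately consider "bounded_index k" | "bounded_index (- k)"
    using bounded_or_cobounded by blast
  then show ?thesis
  proof cases
    case 1
    then obtain \<F> where \<F>: "finite \<F>" "\<F> \<subseteq> removable_sets" "k \<subseteq> \<Union>\<F>"
      by (rule bounded_index_cover)
    have "openin \<tau> (K - Some ` \<Union>\<F>)"
      using K(1) closedin_image_removable_Union[OF \<F>(1,2)] by (rule openin_diff)
    moreover have "K - Some ` \<Union>\<F> = {None}"
    proof (intro set_eqI)
      fix y show "y \<in> K - Some ` \<Union>\<F> \<longleftrightarrow> y \<in> {None}"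
        using K(3) \<F>(3) unfolding k_def by (cases y) auto
    qed
    ultimately show ?thesis by simp
  next
    case 2
    then obtain \<F> where \<F>: "finite \<F>" "\<F> \<subseteq> removable_sets" "- k \<subseteq> \<Union>\<F>"
      by (rule bounded_index_cover)
    have "compactin \<tau> (K \<union> Some ` \<Union>\<F>)"
      using K(2) compactin_image_removable_Union[OF \<F>(1,2)] by (rule compactin_Un)
    moreover have "K \<union> Some ` \<Union>\<F> = topspace \<tau>"
    proof (intro set_eqI)
      fix y show "y \<in> K \<union> Some ` \<Union>\<F> \<longleftrightarrow> y \<in> topspace \<tau>"
        using K(3) \<F>(3) topspace_tau unfolding k_def by (cases y) auto
    qed
    ultimately show ?thesis by (simp add: compact_space_def)
  qed
qed

lemma zero_base_iff:
  "B \<in> zero_base \<longleftrightarrow>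
    (\<exists>\<F>. finite \<F> \<and> \<F> \<noteq> {} \<and> \<F> \<subseteq> removable_sets \<and> B = UNIV - Some ` \<Union>\<F>)"
proof
  assume "B \<in> zero_base"
  then obtain k :: nat and M where "k \<ge> 1" "\<forall>p\<in>{1..k}. M p \<in> removable_sets"
    "B = UNIV - (\<Union>p\<in>{1..k}. Some ` M p)"
    unfolding zero_base_def mem_Collect_eq by (elim exE conjE)
  then show "\<exists>\<F>. finite \<F> \<and> \<F> \<noteq> {} \<and> \<F> \<subseteq> removable_sets \<and> B = UNIV - Some ` \<Union>\<F>"
    by (intro exI[of _ "M ` {1..k}"]) auto
next
  assume "\<exists>\<F>. finite \<F> \<and> \<F> \<noteq> {} \<and> \<F> \<subseteq> removable_sets \<and> B = UNIV - Some ` \<Union>\<F>"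
  then obtain \<F> where \<F>: "finite \<F>" "\<F> \<noteq> {}" "\<F> \<subseteq> removable_sets" "B = UNIV - Some ` \<Union>\<F>"
    by blast
  obtain M where "bij_betw M {1..card \<F>} \<F>"
    using ex_bij_betw_nat_finite_1[OF \<F>(1)] by blast
  then have M: "M ` {1..card \<F>} = \<F>" by (rule bij_betw_imp_surj_on)
  have "card \<F> \<ge> 1" using \<F>(1,2) by (simp add: Suc_leI card_gt_0_iff)
  moreover have "\<forall>p\<in>{1..card \<F>}. M p \<in> removable_sets" using M \<F>(3) by blast
  moreover have "B = UNIV - (\<Union>p\<in>{1..card \<F>}. Some ` M p)"
  proof -
    have "Some ` \<Union>(M ` {1..card \<F>}) = (\<Union>p\<in>{1..card \<F>}. Some ` M p)"
      by (simp add: image_UN)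
    then show ?thesis unfolding M \<F>(4) by simp
  qed
  ultimately show "B \<in> zero_base"
    unfolding zero_base_def mem_Collect_eq by (intro exI conjI)
qed

lemma compact_base_at_zero:
  assumes "compact_space \<tau>"
  shows "base_at \<tau> None zero_base"
  unfolding base_at_def
proof (intro conjI ballI allI impI)
  fix B assume "B \<in> zero_base"
  then obtain \<F> where \<F>: "finite \<F>" "\<F> \<subseteq> removable_sets" "B = UNIV - Some ` \<Union>\<F>"
    unfolding zero_base_iff by blast
  show "openin \<tau> B"
    unfolding \<F>(3) using closedin_image_removable_Union[OF \<F>(1,2)] topspace_tau
    by (metis closedin_def)
  show "None \<in> B" using \<F>(3) by blast
next
  fix U assume U: "openin \<tau> U \<and> None \<in> U"
  then have "compactin \<tau> (topspace \<tau> - U)"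
    by (intro closedin_compact_space[OF assms]) blast
  moreover have "None \<notin> topspace \<tau> - U" using U by blast
  ultimately obtain \<F> where \<F>: "finite \<F>" "\<F> \<subseteq> removable_sets" "topspace \<tau> - U \<subseteq> Some ` \<Union>\<F>"
    by (rule compactin_removable_cover)
  \<comment> \<open>A spare piece makes the family nonempty, as required by \<open>k \<ge> 1\<close>.\<close>
  let ?\<G> = "insert {(0, 0, 0)} \<F>"
  have "{(0, 0, 0)} \<in> removable_sets" unfolding removable_sets_def by blast
  then have "UNIV - Some ` \<Union>?\<G> \<in> zero_base"
    unfolding zero_base_iff using \<F>(1,2) by (intro exI[of _ ?\<G>]) auto
  moreover have "UNIV - Some ` \<Union>?\<G> \<subseteq> U" using \<F>(3) topspace_tau by blast
  ultimately show "\<exists>B\<in>zero_base. B \<subseteq> U" by blast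
qed

end

section \<open>The dichotomy\<close>

theorem theorem4p13:
  fixes \<theta> :: "int \<Rightarrow> int" and \<tau> :: "reilly option topology"
  assumes "\<theta> = (\<lambda>z. 0)"
    and "topspace \<tau> = UNIV"
    and "Hausdorff_space \<tau>"
    and "locally_compact_space \<tau>"
    and "shift_continuous (adjoin_zero (reilly_mult \<theta>)) \<tau>"
    and "pullback_topology UNIV Some \<tau> = tau_cf"
  shows "(compact_space \<tau> \<or> openin \<tau> {None}) \<and>
         (compact_space \<tau> \<longrightarrow> base_at \<tau> None zero_base)"
proof -
  interpret locally_compact_reilly_zero \<tau>
    by unfold_locales (use assms in simp_all)
  show ?thesis using compact_or_zero_isolated compact_base_at_zero by blast
qed

end
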